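(* Let $\mathcal{V}$ be a vector space and let $T,S:\mathcal{V}\to\mathcal{V}$ be commuting linear maps. Then there exist a vector space $\mathcal{W}$ whose elements are infinite matrices $(x_{n,m})_{n,m\in\mathbb{Z}_+}$ with entries in $\mathcal{V}$ (with entrywise operations) and linear maps $I:\mathcal{V}\to\mathcal{W}$ and $U,V,P:\mathcal{W}\to\mathcal{W}$ such that $(\mathcal{W},I,U,P)$ is a linear injective dilation of $T$, $(\mathcal{W},I,V,P)$ is a linear injective dilation of $S$, $$\begin{pmatrix}0_c & U\end{pmatrix}=\begin{pmatrix}0_r\\ V\end{pmatrix},$$ and $$IT^nS^mx=PU^nV^mIx,\qquad\forall n,m\in\mathbb{Z}_+,\ \forall x\in\mathcal{V}.$$ Here $0_c$ denotes the infinite column of zero vectors and $0_r$ the infinite row of zero vectors, and the displayed matrix identity means: for every $w\in\mathcal{W}$, the infinite matrix obtained from $Uw$ by adjoining a zero column on the left equals the infinite matrix obtained from $Vw$ by adjoining a zero row on top.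
   Context: Vector spaces are over an arbitrary field; $\mathbb{Z}_+=\{0,1,2,\dots\}$. Rows and columns of infinite matrices are indexed by $\mathbb{Z}_+$. A linear injective dilation of a linear map $T:\mathcal{V}\to\mathcal{V}$ is a quadruple $(\mathcal{W},I,U,P)$ where $\mathcal{W}$ is a vector space, $I:\mathcal{V}\to\mathcal{W}$ and $U:\mathcal{W}\to\mathcal{W}$ are injective linear maps, and $P:\mathcal{W}\to\mathcal{W}$ is an idempotent linear map with $P(\mathcal{W})=I(\mathcal{V})$, such that $IT^nx=PU^nIx$ for all $n\in\mathbb{Z}_+$ and $x\in\mathcal{V}$. *)

theory Defs
  imports Complex_Main "HOL-Library.Function_Algebras"
begin

text \<open>
  Vector spaces are given by a scalar multiplication on an additive group, as in
  \<^locale>\<open>vector_space\<close>. The space \<open>W\<close> of a dilation is a subspace of an ambient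
  space, so that its existence can be asserted; maps out of \<open>W\<close> are constrained on \<open>W\<close> only.
\<close>

definition linear_map_on ::
  "('k::field \<Rightarrow> 'v::ab_group_add \<Rightarrow> 'v) \<Rightarrow> ('k \<Rightarrow> 'w::ab_group_add \<Rightarrow> 'w) \<Rightarrow>
    'v set \<Rightarrow> 'w set \<Rightarrow> ('v \<Rightarrow> 'w) \<Rightarrow> bool" where
  "linear_map_on s1 s2 A B f \<longleftrightarrow>
     f ` A \<subseteq> B \<and>
     (\<forall>x\<in>A. \<forall>y\<in>A. f (x + y) = f x + f y) \<and>
     (\<forall>c. \<forall>x\<in>A. f (s1 c x) = s2 c (f x))"

definition linear_injective_dilation ::
  "('k::field \<Rightarrow> 'v::ab_group_add \<Rightarrow> 'v) \<Rightarrow> ('v \<Rightarrow> 'v) \<Rightarrow>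
    ('k \<Rightarrow> 'w::ab_group_add \<Rightarrow> 'w) \<Rightarrow> 'w set \<Rightarrow> ('v \<Rightarrow> 'w) \<Rightarrow> ('w \<Rightarrow> 'w) \<Rightarrow> ('w \<Rightarrow> 'w) \<Rightarrow> bool" where
  "linear_injective_dilation sV T sW W I U P \<longleftrightarrow>
     vector_space sV \<and> Vector_Spaces.linear sV sV T \<and>
     vector_space sW \<and> module.subspace sW W \<and>
     linear_map_on sV sW UNIV W I \<and> inj I \<and>
     linear_map_on sW sW W W U \<and> inj_on U W \<and>
     linear_map_on sW sW W W P \<and> (\<forall>w\<in>W. P (P w) = P w) \<and> P ` W = range I \<and>
     (\<forall>n x. I ((T ^^ n) x) = P ((U ^^ n) (I x)))"

text \<open>
  The entry of \<open>A\<close> in row \<open>n\<close> and column \<open>m\<close> is \<open>A n m\<close>. Addition and zero are the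
  pointwise ones of \<^theory>\<open>HOL-Library.Function_Algebras\<close>, hence entrywise.
\<close>

type_synonym 'v inf_matrix = "nat \<Rightarrow> nat \<Rightarrow> 'v"

definition entrywise_scale ::
  "('k \<Rightarrow> 'v \<Rightarrow> 'v) \<Rightarrow> 'k \<Rightarrow> 'v inf_matrix \<Rightarrow> 'v inf_matrix" where
  "entrywise_scale s c A = (\<lambda>n m. s c (A n m))"

definition adjoin_zero_column :: "'v::zero inf_matrix \<Rightarrow> 'v inf_matrix" where
  "adjoin_zero_column A = (\<lambda>n m. case m of 0 \<Rightarrow> 0 | Suc j \<Rightarrow> A n j)"

definition adjoin_zero_row :: "'v::zero inf_matrix \<Rightarrow> 'v inf_matrix" where
  "adjoin_zero_row A = (\<lambda>n m. case n of 0 \<Rightarrow> 0 | Suc i \<Rightarrow> A i m)"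

end

theory Submission
  imports Defs "HOL-Library.Groups_Big_Fun"
begin

text \<open>
  On finitely supported matrices let \<open>U\<close> and \<open>V\<close> be the shifts that insert a zero row and a
  zero column; they are injective, and inserting first one and then the other gives the same
  result in either order. With \<open>I x\<close> the matrix with \<open>x\<close> in the corner and zeros elsewhere,
  \<open>U\<^sup>n V\<^sup>m I x\<close> has the single entry \<open>x\<close> at position \<open>(n, m)\<close>. Hence the projection
  \<open>P A = I (\<Sum>n m. T\<^sup>n S\<^sup>m A\<^sub>n\<^sub>m)\<close> does the job.
\<close>

text \<open>This is the space \<open>W\<close>. Finite support keeps the sum that defines the
  projection finite, and it survives both shifts.\<close>

definition fin_supp_matrices :: "'v::zero inf_matrix set" where
  "fin_supp_matrices = {A. finite {(n, m). A n m \<noteq> 0}}"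

definition single_entry :: "nat \<Rightarrow> nat \<Rightarrow> 'v::zero \<Rightarrow> 'v inf_matrix" where
  "single_entry n m x = (\<lambda>i j. if i = n \<and> j = m then x else 0)"

text \<open>\<open>Sum_any\<close> adds up the nonzero summands and returns 0 when there are
  infinitely many, so this function is total, but linearity is claimed only on
  \<open>fin_supp_matrices\<close>.\<close>

definition sum_entries ::
  "(nat \<Rightarrow> nat \<Rightarrow> 'v \<Rightarrow> 'w::comm_monoid_add) \<Rightarrow> 'v inf_matrix \<Rightarrow> 'w" where
  "sum_entries F A = Sum_any (\<lambda>(n, m). F n m (A n m))"

lemma vector_space_entrywise_scale:
  assumes "vector_space scale"
  shows "vector_space (entrywise_scale scale)"
proof -
  interpret vector_space scale by fact
  show ?thesis
    by unfold_locales (simp_all add: entrywise_scale_def fun_eq_iff scale_right_distrib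
        scale_left_distrib)
qed

lemma subspace_fin_supp_matrices:
  assumes "vector_space scale"
  shows "module.subspace (entrywise_scale scale) fin_supp_matrices"
proof -
  interpret vector_space scale by fact
  interpret matrices: vector_space "entrywise_scale scale"
    using assms by (rule vector_space_entrywise_scale)
  show ?thesis
  proof (rule matrices.subspaceI)
    show "0 \<in> fin_supp_matrices"
      by (simp add: fin_supp_matrices_def)
  next
    fix A B :: "'b inf_matrix"
    assume "A \<in> fin_supp_matrices" "B \<in> fin_supp_matrices"
    then have "finite ({(n, m). A n m \<noteq> 0} \<union> {(n, m). B n m \<noteq> 0})"
      by (simp add: fin_supp_matrices_def)
    then show "A + B \<in> fin_supp_matrices"
      unfolding fin_supp_matrices_def mem_Collect_eq by (rule rev_finite_subset) auto
  next
    fix c and A :: "'b inf_matrix"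
    assume "A \<in> fin_supp_matrices"
    then show "entrywise_scale scale c A \<in> fin_supp_matrices"
      unfolding fin_supp_matrices_def mem_Collect_eq
      by (rule rev_finite_subset) (auto simp: entrywise_scale_def)
  qed
qed

lemma single_entry_in_fin_supp_matrices: "single_entry n m x \<in> fin_supp_matrices"
  unfolding fin_supp_matrices_def mem_Collect_eq
  by (rule finite_subset[of _ "{(n, m)}"]) (auto simp: single_entry_def)

lemma inj_single_entry: "inj (single_entry n m)"
  by (rule injI) (metis single_entry_def)

lemma linear_map_on_single_entry:
  assumes "vector_space scale"
  shows "linear_map_on scale (entrywise_scale scale) UNIV fin_supp_matrices (single_entry n m)"
proof -
  interpret vector_space scale by fact
  show ?thesis
    by (auto simp: linear_map_on_def single_entry_in_fin_supp_matrices)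
      (simp_all add: single_entry_def entrywise_scale_def fun_eq_iff)
qed

lemma linear_map_on_adjoin_zero_row:
  assumes "vector_space scale"
  shows "linear_map_on (entrywise_scale scale) (entrywise_scale scale)
    fin_supp_matrices fin_supp_matrices adjoin_zero_row"
proof -
  interpret vector_space scale by fact
  have "adjoin_zero_row A \<in> fin_supp_matrices" if "A \<in> fin_supp_matrices" for A :: "'b inf_matrix"
  proof -
    \<comment> \<open>The inserted row is zero, so the new support lies in the old one moved down by
      one row.\<close>
    have "finite ((\<lambda>(n, m). (Suc n, m)) ` {(n, m). A n m \<noteq> 0})"
      using that by (simp add: fin_supp_matrices_def)
    then show ?thesis
      unfolding fin_supp_matrices_def mem_Collect_eq
      by (rule rev_finite_subset) (force simp: adjoin_zero_row_def split: nat.splits)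
  qed
  then show ?thesis
    by (auto simp: linear_map_on_def)
      (simp_all add: adjoin_zero_row_def entrywise_scale_def fun_eq_iff split: nat.splits)
qed

lemma linear_map_on_adjoin_zero_column:
  assumes "vector_space scale"
  shows "linear_map_on (entrywise_scale scale) (entrywise_scale scale)
    fin_supp_matrices fin_supp_matrices adjoin_zero_column"
proof -
  interpret vector_space scale by fact
  have "adjoin_zero_column A \<in> fin_supp_matrices" if "A \<in> fin_supp_matrices" for A :: "'b inf_matrix"
  proof -
    have "finite ((\<lambda>(n, m). (n, Suc m)) ` {(n, m). A n m \<noteq> 0})"
      using that by (simp add: fin_supp_matrices_def)
    then show ?thesis
      unfolding fin_supp_matrices_def mem_Collect_eq
      by (rule rev_finite_subset) (force simp: adjoin_zero_column_def split: nat.splits)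
  qed
  then show ?thesis
    by (auto simp: linear_map_on_def)
      (simp_all add: adjoin_zero_column_def entrywise_scale_def fun_eq_iff split: nat.splits)
qed

lemma inj_adjoin_zero_row: "inj adjoin_zero_row"
proof (rule injI, intro ext)
  fix A B :: "'a inf_matrix" and n m
  assume "adjoin_zero_row A = adjoin_zero_row B"
  then have "adjoin_zero_row A (Suc n) m = adjoin_zero_row B (Suc n) m" by simp
  then show "A n m = B n m" by (simp add: adjoin_zero_row_def)
qed

lemma inj_adjoin_zero_column: "inj adjoin_zero_column"
proof (rule injI, intro ext)
  fix A B :: "'a inf_matrix" and n m
  assume "adjoin_zero_column A = adjoin_zero_column B"
  then have "adjoin_zero_column A n (Suc m) = adjoin_zero_column B n (Suc m)" by simp
  then show "A n m = B n m" by (simp add: adjoin_zero_column_def)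
qed

text \<open>Both sides are \<open>A\<close> framed by a zero first row and a zero first column. With
  the row insertion as \<open>U\<close> and the column insertion as \<open>V\<close>, this is the
  required matrix identity.\<close>

lemma adjoin_zero_column_row_commute:
  "adjoin_zero_column (adjoin_zero_row A) = adjoin_zero_row (adjoin_zero_column A)"
  by (simp add: adjoin_zero_column_def adjoin_zero_row_def fun_eq_iff split: nat.splits)

text \<open>The starting position is arbitrary because the row shifts act after the column shifts,
  on an entry that has already left the corner.\<close>

lemma funpow_adjoin_zero_row_single_entry:
  "(adjoin_zero_row ^^ k) (single_entry n m x) = single_entry (k + n) m x"
  by (induction k)
    (auto simp: single_entry_def adjoin_zero_row_def fun_eq_iff split: nat.splits)

lemma funpow_adjoin_zero_column_single_entry:
  "(adjoin_zero_column ^^ k) (single_entry n m x) = single_entry n (k + m) x"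
  by (induction k)
    (auto simp: single_entry_def adjoin_zero_column_def fun_eq_iff split: nat.splits)

lemma sum_entries_single_entry:
  assumes "\<And>i j. F i j 0 = 0"
  shows "sum_entries F (single_entry n m x) = F n m x"
proof -
  have "sum_entries F (single_entry n m x) =
      (\<Sum>(i, j)\<in>{(n, m)}. F i j (single_entry n m x i j))"
    unfolding sum_entries_def
    \<comment> \<open>The singleton is only a superset of the support of the summand, since
      \<open>F n m x\<close> may vanish.\<close>
    by (rule Sum_any.expand_superset) (auto simp: single_entry_def assms split: if_splits)
  then show ?thesis
    by (simp add: single_entry_def)
qed

text \<open>Each \<open>F n m\<close> maps 0 to 0, so the summands inherit finite support from the
  matrix, and the laws of finite sums apply.\<close>

lemma linear_map_on_sum_entries:
  assumes "\<And>n m. Vector_Spaces.linear sV sW (F n m)"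
  shows "linear_map_on (entrywise_scale sV) sW fin_supp_matrices UNIV (sum_entries F)"
proof -
  interpret F: Vector_Spaces.linear sV sW "F n m" for n m by (rule assms)
  have fin: "finite {p. (case p of (n, m) \<Rightarrow> F n m (A n m)) \<noteq> 0}"
    if "A \<in> fin_supp_matrices" for A
    using that unfolding fin_supp_matrices_def mem_Collect_eq
    by (rule rev_finite_subset) (auto simp: F.zero)
  have add: "sum_entries F (A + B) = sum_entries F A + sum_entries F B"
    if "A \<in> fin_supp_matrices" "B \<in> fin_supp_matrices" for A B
    using Sum_any.distrib[OF that[THEN fin]]
    by (simp add: sum_entries_def F.add case_prod_unfold)
  have scale: "sum_entries F (entrywise_scale sV c A) = sW c (sum_entries F A)"
    if "A \<in> fin_supp_matrices" for c A
  proof -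
    \<comment> \<open>Scaling can shrink the support, for instance when \<open>c = 0\<close>; both
      sums are therefore taken over the support of the unscaled summands.\<close>
    let ?S = "{p. (case p of (n, m) \<Rightarrow> F n m (A n m)) \<noteq> 0}"
    have "sum_entries F (entrywise_scale sV c A) =
        (\<Sum>(n, m)\<in>?S. F n m (entrywise_scale sV c A n m))"
      unfolding sum_entries_def
      by (rule Sum_any.expand_superset[OF fin[OF that]])
        (auto simp: entrywise_scale_def F.scale)
    also have "\<dots> = sW c (\<Sum>(n, m)\<in>?S. F n m (A n m))"
      by (simp add: entrywise_scale_def F.scale F.vs2.scale_sum_right case_prod_unfold)
    finally show ?thesis
      by (simp add: sum_entries_def Sum_any.expand_set)
  qed
  show ?thesis
    by (simp add: linear_map_on_def add scale)
qed

lemma linear_funpow: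
  assumes "Vector_Spaces.linear s s f"
  shows "Vector_Spaces.linear s s (f ^^ n)"
proof (induction n)
  case 0
  interpret Vector_Spaces.linear s s f by fact
  show ?case using vs1.linear_id by (simp add: id_def)
next
  case (Suc n)
  then show ?case using Vector_Spaces.linear_compose[OF Suc assms] by (simp add: o_def)
qed

theorem theorem2p15:
  fixes scale :: "'k::field \<Rightarrow> 'v::ab_group_add \<Rightarrow> 'v"
    and T S :: "'v \<Rightarrow> 'v"
  assumes "vector_space scale"
    and "Vector_Spaces.linear scale scale T"
    and "Vector_Spaces.linear scale scale S"
    and "T \<circ> S = S \<circ> T"
  shows "\<exists>(W :: 'v inf_matrix set) (I :: 'v \<Rightarrow> 'v inf_matrix)
            (U :: 'v inf_matrix \<Rightarrow> 'v inf_matrix) (V :: 'v inf_matrix \<Rightarrow> 'v inf_matrix)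
            (P :: 'v inf_matrix \<Rightarrow> 'v inf_matrix).
           linear_injective_dilation scale T (entrywise_scale scale) W I U P \<and>
           linear_injective_dilation scale S (entrywise_scale scale) W I V P \<and>
           (\<forall>w\<in>W. adjoin_zero_column (U w) = adjoin_zero_row (V w)) \<and>
           (\<forall>n m x. I ((T ^^ n) ((S ^^ m) x)) = P ((U ^^ n) ((V ^^ m) (I x))))"
proof -
  \<comment> \<open>The joint dilation identity forces \<open>P\<close> to send the single entry
    \<open>x\<close> at position \<open>(n, m)\<close> to \<open>I (F n m x)\<close>. Single entries
    span the finitely supported matrices, so linearity leaves no other choice for \<open>P\<close>
    there.\<close>
  define F where "F n m = (T ^^ n) \<circ> (S ^^ m)" for n m
  define I :: "'v \<Rightarrow> 'v inf_matrix" where "I = single_entry 0 0"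
  define P where "P = I \<circ> sum_entries F"
  have lin_F: "Vector_Spaces.linear scale scale (F n m)" for n m
    unfolding F_def
    using Vector_Spaces.linear_compose[OF linear_funpow[OF assms(3)] linear_funpow[OF assms(2)]] .
  interpret F: Vector_Spaces.linear scale scale "F n m" for n m by (rule lin_F)
  have lin_I: "linear_map_on scale (entrywise_scale scale) UNIV fin_supp_matrices I"
    unfolding I_def using assms(1) by (rule linear_map_on_single_entry)
  have "linear_map_on (entrywise_scale scale) scale fin_supp_matrices UNIV (sum_entries F)"
    using lin_F by (rule linear_map_on_sum_entries)
  with lin_I have lin_P: "linear_map_on (entrywise_scale scale) (entrywise_scale scale)
      fin_supp_matrices fin_supp_matrices P"
    by (auto simp: linear_map_on_def P_def)
  \<comment> \<open>All dilation identities are instances of this one: \<open>m = 0\<close> gives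
    that of \<open>T\<close>, \<open>n = 0\<close> that of \<open>S\<close>, and
    \<open>n = m = 0\<close> shows that \<open>P\<close> fixes the range of
    \<open>I\<close>.\<close>
  have dil: "I ((T ^^ n) ((S ^^ m) x)) =
      P ((adjoin_zero_row ^^ n) ((adjoin_zero_column ^^ m) (I x)))" for n m x
    \<comment> \<open>\<open>F\<close> stays folded at first, so that \<open>F.zero\<close> can
      discharge the premise of \<open>sum_entries_single_entry\<close>.\<close>
    by (simp add: P_def I_def funpow_adjoin_zero_row_single_entry
        funpow_adjoin_zero_column_single_entry sum_entries_single_entry F.zero)
      (simp add: F_def)
  have P_I: "P (I x) = I x" for x
    using dil[of 0 0 x] by simp
  \<comment> \<open>Every value of \<open>P\<close> has the form \<open>I x\<close>, and such values
    are fixed by \<open>P\<close>; membership of \<open>w\<close> in the subspace does not matter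
    here.\<close>
  have idem: "P (P w) = P w" for w
    using P_I by (simp add: P_def)
  have range: "P ` fin_supp_matrices = range I"
  proof
    show "P ` fin_supp_matrices \<subseteq> range I"
      by (auto simp: P_def)
    show "range I \<subseteq> P ` fin_supp_matrices"
      using P_I single_entry_in_fin_supp_matrices by (metis I_def image_subsetI imageI)
  qed
  have "inj I"
    unfolding I_def by (rule inj_single_entry)
  note common = assms(1-3) vector_space_entrywise_scale[OF assms(1)]
    subspace_fin_supp_matrices[OF assms(1)] lin_I this lin_P idem range
  have "linear_injective_dilation scale T (entrywise_scale scale) fin_supp_matrices I
      adjoin_zero_row P"
    using common linear_map_on_adjoin_zero_row[OF assms(1)] dil[of _ 0]
      inj_on_subset[OF inj_adjoin_zero_row subset_UNIV]
    by (simp add: linear_injective_dilation_def)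
  moreover have "linear_injective_dilation scale S (entrywise_scale scale) fin_supp_matrices I
      adjoin_zero_column P"
    using common linear_map_on_adjoin_zero_column[OF assms(1)] dil[of 0]
      inj_on_subset[OF inj_adjoin_zero_column subset_UNIV]
    by (simp add: linear_injective_dilation_def)
  ultimately show ?thesis
    using dil adjoin_zero_column_row_commute by blast
qed

end
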